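(* Let $m \ge n \ge 1$, let $A \in \mathbb{R}^{m\times m}$ be symmetric positive definite, and let $Z \in \mathbb{R}^{m\times n}$ have full rank $n$. Let $\hat Z \in \mathbb{R}^{m\times n}$ be a matrix whose columns form an orthonormal basis (in the Euclidean inner product) of the column space of $Z$. Let $Q \in \mathbb{R}^{m\times n}$ and $R \in \mathbb{R}^{n\times n}$ be the factors of an oblique $QR$ factorization of $Z$ in the $A$ inner product, i.e. $Z = QR$, $R$ is upper triangular, and $Q^T A Q = I$. Then for all $i = 1,\dots,n$, $$\sigma_i(Q) = \sigma_{n-i+1}(A^{1/2}\hat Z)^{-1}, \qquad \sigma_i(R) = \sigma_i(A^{1/2} Z).$$ In particular, $\|Q\|_2 = \sigma_n(A^{1/2}\hat Z)^{-1}$ and $\|R\|_2 = \|A^{1/2} Z\|_2$.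
   Context: For a matrix $M$ with $n$ columns and at least $n$ rows, $\sigma_1(M) \ge \sigma_2(M) \ge \dots \ge \sigma_n(M)$ denote its singular values in non-increasing order. $A^{1/2}$ is the symmetric positive definite square root of $A$. $\|\cdot\|_2$ is the spectral norm. *)

theory Defs
  imports Complex_Main "Jordan_Normal_Form.Char_Poly" "Jordan_Normal_Form.DL_Rank"
begin

definition spd :: "nat \<Rightarrow> real mat \<Rightarrow> bool" where
  "spd m A \<longleftrightarrow> A \<in> carrier_mat m m \<and> transpose_mat A = A \<and>
     (\<forall>x \<in> carrier_vec m. x \<noteq> 0\<^sub>v m \<longrightarrow> 0 < x \<bullet> (A *\<^sub>v x))"

(* The definite description is meaningful when A is symmetric positive definite,
   where the square root exists and is unique. *)
definition sqrt_mat :: "real mat \<Rightarrow> real mat" where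
  "sqrt_mat A = (THE B. spd (dim_row A) B \<and> B * B = A)"

(* Square roots of the eigenvalues of the Gram matrix, repeated according to algebraic
   multiplicity and in non-increasing order. As the Gram matrix is symmetric, all roots of its
   characteristic polynomial are real and the list has length dim_col M. *)
definition singular_values :: "real mat \<Rightarrow> real list" where
  "singular_values M =
     rev (sorted_list_of_multiset (image_mset sqrt (proots (char_poly (transpose_mat M * M)))))"

(* Indices start at 1; only i in {1..dim_col M} is meaningful. *)
definition singular_value :: "nat \<Rightarrow> real mat \<Rightarrow> real" where
  "singular_value i M = singular_values M ! (i - 1)"

definition euclidean_norm :: "real vec \<Rightarrow> real" where
  "euclidean_norm x = sqrt (x \<bullet> x)"

(* The operator norm; dim_col M must be positive for the set of unit vectors to be nonempty. *)
definition spectral_norm :: "real mat \<Rightarrow> real" where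
  "spectral_norm M =
     (SUP x \<in> {x \<in> carrier_vec (dim_col M). euclidean_norm x = 1}. euclidean_norm (M *\<^sub>v x))"

definition column_space :: "real mat \<Rightarrow> real vec set" where
  "column_space M =
     LinearCombinations.module.span class_ring (module_vec TYPE(real) (dim_row M)) (set (cols M))"

(* Linear independence of the columns of B follows from their orthonormality. *)
definition orthonormal_basis_columns :: "real mat \<Rightarrow> real vec set \<Rightarrow> bool" where
  "orthonormal_basis_columns B V \<longleftrightarrow>
     (\<forall>i < dim_col B. \<forall>j < dim_col B. col B i \<bullet> col B j = (if i = j then 1 else 0)) \<and>
     column_space B = V"

definition oblique_QR :: "real mat \<Rightarrow> real mat \<Rightarrow> real mat \<Rightarrow> real mat \<Rightarrow> bool" where
  "oblique_QR A Z Q R \<longleftrightarrow>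
     Q \<in> carrier_mat (dim_row Z) (dim_col Z) \<and> R \<in> carrier_mat (dim_col Z) (dim_col Z) \<and>
     Z = Q * R \<and> upper_triangular R \<and> transpose_mat Q * A * Q = 1\<^sub>m (dim_col Z)"

end

theory Submission
  imports Defs "HOL-Computational_Algebra.Fundamental_Theorem_Algebra"
begin

text \<open>
  Since Q^T A Q = I, the Gram matrix of A^(1/2) Z = A^(1/2) Q R is R^T R, so R and A^(1/2) Z have
  the same singular values. For Q, put S = Zhat^T Q. The columns of Zhat and Q span the same space,
  so S is invertible and Q = Zhat S. Hence Q^T Q = S^T S is similar to S S^T, while
  Q^T A Q = S^T G S = I, with G = Zhat^T A Zhat the Gram matrix of A^(1/2) Zhat, says that S S^T is
  the inverse of G. The spectral theorem for real symmetric matrices, obtained by deflation with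
  Householder reflections, turns these relations into statements about singular values.
\<close>

section \<open>Spectral theorem for real symmetric matrices\<close>

text \<open>If v differs from the first unit vector, \<open>W\<close> is the reflection in the
  hyperplane orthogonal to their difference; the two vectors have equal length, so it swaps them.
  Conjugation by \<open>W\<close> moves an eigenvector v onto the first axis.\<close>

lemma householder_reflection:
  fixes v :: "real vec"
  assumes v: "v \<in> carrier_vec n" and unit: "v \<bullet> v = 1" and n: "0 < n"
  obtains W :: "real mat" where "W \<in> carrier_mat n n" "transpose_mat W = W" "W * W = 1\<^sub>m n"
    "W *\<^sub>v unit_vec n 0 = v"
proof -
  \<comment> \<open>If v is the unit vector itself, then s = 0, hence c = 2 / 0 = 0 and W is the identity.\<close>
  define u where "u i = v $ i - (if i = 0 then 1 else 0)" for i
  define s where "s = (\<Sum>i<n. u i * u i)"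
  define c where "c = 2 / s"
  define W where "W = mat n n (\<lambda>(i,j). (if i = j then 1 else 0) - c * u i * u j)"
  have W: "W \<in> carrier_mat n n" by (simp add: W_def)
  have "(\<Sum>i<n. v $ i * v $ i) = 1"
    using unit v by (simp add: scalar_prod_def atLeast0LessThan)
  moreover have "u i * u i = v $ i * v $ i - 2 * (if i = 0 then v $ 0 else 0) + (if i = 0 then 1 else 0)" for i
    by (simp add: u_def algebra_simps)
  ultimately have s: "s = 2 - 2 * v $ 0"
    using n by (simp add: s_def sum.distrib sum_subtractf flip: sum_distrib_left)
  \<comment> \<open>This identity cancels the terms in \<open>u i * u j\<close> when
    \<open>W\<close> is squared, also for s = 0.\<close>
  have cs: "c * c * s = 2 * c" by (simp add: c_def)
  have "W * W = 1\<^sub>m n"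
  proof (rule eq_matI)
    fix i j assume ij: "i < dim_row (1\<^sub>m n :: real mat)" "j < dim_col (1\<^sub>m n :: real mat)"
    have "(W * W) $$ (i,j) = (\<Sum>k<n. ((if i = k then 1 else 0) - c * u i * u k) *
        ((if k = j then 1 else 0) - c * u k * u j))"
      using ij by (simp add: W_def scalar_prod_def atLeast0LessThan)
    also have "\<dots> = (\<Sum>k<n. (if k = i then (if i = j then 1 else 0) else 0) - (if k = i then c * u i * u j else 0)
        - (if k = j then c * u i * u j else 0) + (c * c * u i * u j) * (u k * u k))"
      by (intro sum.cong refl) (auto simp: algebra_simps)
    also have "\<dots> = (if i = j then 1 else 0) - 2 * c * u i * u j + (c * c * s) * u i * u j"
      using ij by (simp add: sum.distrib sum_subtractf s_def sum_distrib_left sum_distrib_right algebra_simps)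
    also have "\<dots> = 1\<^sub>m n $$ (i,j)" using ij by (simp add: cs)
    finally show "(W * W) $$ (i,j) = 1\<^sub>m n $$ (i,j)" .
  qed (use W in auto)
  moreover have "W *\<^sub>v unit_vec n 0 = v"
  proof (rule eq_vecI)
    fix i assume "i < dim_vec v"
    hence i: "i < n" using v by simp
    have "(W *\<^sub>v unit_vec n 0) $ i = W $$ (i,0)" using i n W by simp
    also have "\<dots> = v $ i"
    proof (cases "s = 0")
      case True
      hence "u i * u i = 0"
        using i unfolding s_def by (subst (asm) sum_nonneg_eq_0_iff) auto
      thus ?thesis using i n True by (simp add: W_def c_def u_def)
    next
      case False
      \<comment> \<open>Here u 0 = v $ 0 - 1 = - s / 2. Hence column 0 of \<open>W\<close> is the
        first unit vector plus u, which is v.\<close>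
      have "c * u 0 = - 1" using False by (simp add: c_def s u_def field_simps)
      moreover have "c * u i * u 0 = u i * (c * u 0)" by (simp add: ac_simps)
      ultimately have "c * u i * u 0 = - u i" by simp
      thus ?thesis using i n by (simp add: W_def u_def)
    qed
    finally show "(W *\<^sub>v unit_vec n 0) $ i = v $ i" .
  qed (use W v in auto)
  moreover have "transpose_mat W = W"
    by (rule eq_matI) (auto simp: W_def)
  ultimately show thesis using W that by blast
qed

text \<open>The fundamental theorem of algebra supplies a complex root of the characteristic
  polynomial; symmetry forces it to be real, and a real root has a real eigenvector.\<close>

lemma symmetric_real_eigenvector:
  fixes H :: "real mat"
  assumes H: "H \<in> carrier_mat n n" and sym: "transpose_mat H = H" and n: "0 < n"
  obtains e v where "v \<in> carrier_vec n" "v \<bullet> v = 1" "H *\<^sub>v v = e \<cdot>\<^sub>v v"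
proof -
  let ?H = "map_mat complex_of_real H"
  have HC: "?H \<in> carrier_mat n n" using H by simp
  have "degree (char_poly ?H) = n" using degree_monic_char_poly[OF HC] by simp
  then obtain z where z: "poly (char_poly ?H) z = 0"
    using fundamental_theorem_of_algebra[of "char_poly ?H"] n
    by (metis constant_degree neq0_conv)
  then obtain x where x: "x \<in> carrier_vec n" "x \<noteq> 0\<^sub>v n" "?H *\<^sub>v x = z \<cdot>\<^sub>v x"
    using eigenvalue_root_char_poly[OF HC] HC unfolding eigenvalue_def eigenvector_def by auto
  have cx: "conjugate x \<in> carrier_vec n" using x by simp
  have symC: "transpose_mat ?H = ?H"
  proof -
    have "transpose_mat ?H = map_mat complex_of_real (transpose_mat H)" by (rule eq_matI) auto
    thus ?thesis by (simp only: sym)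
  qed
  \<comment> \<open>The entries of \<open>H\<close> are real, so multiplication by \<open>H\<close>
    commutes with complex conjugation.\<close>
  have conjH: "?H *\<^sub>v conjugate x = conjugate (?H *\<^sub>v x)"
    using x(1) H by (intro eq_vecI) (auto simp: scalar_prod_def sum_conjugate conjugate_dist_mul)
  have "cnj z * (conjugate x \<bullet> x) = (?H *\<^sub>v conjugate x) \<bullet> x"
    unfolding conjH x(3) using x(1) by (simp add: conjugate_smult_vec)
  also have "\<dots> = conjugate x \<bullet> (?H *\<^sub>v x)"
    using transpose_vec_mult_scalar[OF HC x(1) cx] symC by simp
  also have "\<dots> = z * (conjugate x \<bullet> x)"
    unfolding x(3) using x(1) by simp
  \<comment> \<open>A real symmetric matrix is Hermitian over the complex numbers, so its eigenvalues are real.\<close>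
  finally have "cnj z = z"
    using x(1,2) by (simp add: conjugate_square_eq_0_vec flip: conjugate_vec_sprod_comm)
  then obtain e where e: "z = complex_of_real e"
    by (metis Reals_cases Reals_cnj_iff)
  \<comment> \<open>The complex eigenvector x may fail to be real; a real one comes from viewing e
    as a root of the characteristic polynomial over the reals.\<close>
  have "complex_of_real (poly (char_poly H) e) = 0"
    using z unfolding e of_real_hom.char_poly_hom[OF H] by simp
  hence "eigenvalue H e" using eigenvalue_root_char_poly[OF H] by simp
  then obtain w where w: "w \<in> carrier_vec n" "w \<noteq> 0\<^sub>v n" "H *\<^sub>v w = e \<cdot>\<^sub>v w"
    using H unfolding eigenvalue_def eigenvector_def by auto
  have "conjugate w = w" by (rule eq_vecI) auto
  hence pos: "0 < w \<bullet> w"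
    using conjugate_square_greater_0_vec[of w n] w by simp
  define v where "v = (1 / sqrt (w \<bullet> w)) \<cdot>\<^sub>v w"
  have "v \<in> carrier_vec n" using w by (simp add: v_def)
  moreover have "v \<bullet> v = 1" using w pos by (simp add: v_def)
  moreover have "H *\<^sub>v v = e \<cdot>\<^sub>v v"
    using w H by (simp add: v_def mult_mat_vec smult_smult_assoc mult.commute)
  ultimately show thesis using that by blast
qed

text \<open>Deflation: a unit eigenvector is reflected onto the first axis. The matrix then splits
  into a 1 by 1 block and a smaller symmetric block, to which the induction hypothesis
  applies.\<close>

lemma real_spectral_theorem:
  fixes H :: "real mat"
  assumes "H \<in> carrier_mat n n" "transpose_mat H = H"
  shows "\<exists>P d. P \<in> carrier_mat n n \<and> transpose_mat P * P = 1\<^sub>m n \<and>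
    H = P * mat_diag n d * transpose_mat P"
  using assms
proof (induction n arbitrary: H)
  case 0
  show ?case using 0 by (intro exI[of _ "1\<^sub>m 0"] exI[of _ undefined]) auto
next
  case (Suc k)
  let ?n = "Suc k"
  note H = Suc.prems(1)
  obtain e v where v: "v \<in> carrier_vec ?n" "v \<bullet> v = 1" and Hv: "H *\<^sub>v v = e \<cdot>\<^sub>v v"
    using symmetric_real_eigenvector[OF Suc.prems] by blast
  obtain W where W: "W \<in> carrier_mat ?n ?n" and Wt: "transpose_mat W = W"
    and WW: "W * W = 1\<^sub>m ?n" and Wv: "W *\<^sub>v unit_vec ?n 0 = v"
    using householder_reflection[OF v] by blast
  define K where "K = W * H * W"
  have K: "K \<in> carrier_mat ?n ?n" using W H by (simp add: K_def)
  have Kt: "transpose_mat K = K"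
    using W H Suc.prems(2) by (simp add: K_def transpose_mult[of _ ?n ?n _ ?n] Wt assoc_mult_mat[of _ ?n ?n _ ?n _ ?n])
  have HK: "H = W * K * W"
  proof -
    have "W * K * W = (W * W) * H * (W * W)"
      using W H by (simp add: K_def assoc_mult_mat[of _ ?n ?n _ ?n _ ?n])
    thus ?thesis using H by (simp add: WW)
  qed
  \<comment> \<open>\<open>W\<close> sends the first unit vector to the eigenvector v and, being an
    involution, sends v back.\<close>
  have "K *\<^sub>v unit_vec ?n 0 = W *\<^sub>v (H *\<^sub>v (W *\<^sub>v unit_vec ?n 0))"
    using W H by (simp add: K_def assoc_mult_mat_vec[of _ ?n ?n _ ?n])
  also have "\<dots> = e \<cdot>\<^sub>v (W *\<^sub>v v)"
    using W v by (simp add: Wv Hv mult_mat_vec)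
  also have "W *\<^sub>v v = (W * W) *\<^sub>v unit_vec ?n 0"
    using W by (simp add: assoc_mult_mat_vec[of _ ?n ?n _ ?n] flip: Wv)
  finally have Ke: "K *\<^sub>v unit_vec ?n 0 = e \<cdot>\<^sub>v unit_vec ?n 0" by (simp add: WW)
  have K0: "K $$ (i,0) = (if i = 0 then e else 0)" if "i < ?n" for i
    using arg_cong[OF Ke, of "\<lambda>x. x $ i"] that K by simp
  \<comment> \<open>Symmetry carries the zeros of the first column to the first row, which makes
    \<open>K\<close> block diagonal.\<close>
  have K0': "K $$ (0,i) = (if i = 0 then e else 0)" if "i < ?n" for i
    using K0[OF that] arg_cong[OF Kt, of "\<lambda>X. X $$ (i,0)"] that K by simp
  define H' where "H' = mat k k (\<lambda>(i,j). K $$ (Suc i, Suc j))"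
  have H': "H' \<in> carrier_mat k k" by (simp add: H'_def)
  have "transpose_mat H' = H'"
  proof (rule eq_matI)
    fix i j assume "i < dim_row H'" "j < dim_col H'"
    thus "transpose_mat H' $$ (i,j) = H' $$ (i,j)"
      using arg_cong[OF Kt, of "\<lambda>X. X $$ (Suc i,Suc j)"] K by (simp add: H'_def)
  qed (use H' in auto)
  then obtain P' d' where P': "P' \<in> carrier_mat k k" and PP': "transpose_mat P' * P' = 1\<^sub>m k"
    and H'P: "H' = P' * mat_diag k d' * transpose_mat P'"
    using Suc.IH[OF H'] by blast
  let ?E = "mat 1 1 (\<lambda>_. e)"
  \<comment> \<open>\<open>F\<close> extends \<open>P'\<close> by the first axis, and
    \<open>d\<close> correspondingly prepends e to the eigenvalues of the smaller block.\<close>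
  define F where "F = four_block_mat (1\<^sub>m 1) (0\<^sub>m 1 k) (0\<^sub>m k 1) P'"
  define d where "d = case_nat e d'"
  have F: "F \<in> carrier_mat ?n ?n" using P' unfolding F_def by auto
  have Ft: "transpose_mat F = four_block_mat (1\<^sub>m 1) (0\<^sub>m 1 k) (0\<^sub>m k 1) (transpose_mat P')"
    unfolding F_def using P' by (subst transpose_four_block_mat[of _ 1 1 _ k _ k]) auto
  have FF: "transpose_mat F * F = 1\<^sub>m ?n"
    unfolding Ft unfolding F_def using P' PP'
    by (subst mult_four_block_mat[of _ 1 1 _ k _ k _ _ 1 _ k]) auto
  have D: "mat_diag ?n d = four_block_mat ?E (0\<^sub>m 1 k) (0\<^sub>m k 1) (mat_diag k d')"
    by (rule eq_matI) (auto simp: mat_diag_def d_def split: nat.splits)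
  have "K = four_block_mat ?E (0\<^sub>m 1 k) (0\<^sub>m k 1) H'"
    using K K0 K0' by (intro eq_matI) (auto simp: H'_def)
  also have "\<dots> = F * mat_diag ?n d * transpose_mat F"
  proof -
    have "F * mat_diag ?n d = four_block_mat ?E (0\<^sub>m 1 k) (0\<^sub>m k 1) (P' * mat_diag k d')"
      unfolding D F_def using P' mat_diag_dim[of k d']
      by (subst mult_four_block_mat[of _ 1 1 _ k _ k _ _ 1 _ k]) (auto simp del: mat_diag_dim)
    thus ?thesis
      unfolding Ft H'P using P' mat_diag_dim[of k d']
      by (simp only:, subst mult_four_block_mat[of _ 1 1 _ k _ k _ _ 1 _ k]) (auto simp del: mat_diag_dim)
  qed
  finally have KF: "K = F * mat_diag ?n d * transpose_mat F" .
  define P where "P = W * F"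
  have Pt: "transpose_mat P = transpose_mat F * W"
    using W F by (simp add: P_def transpose_mult[of _ ?n ?n _ ?n] Wt)
  have "transpose_mat P * P = transpose_mat F * (W * W) * F"
    unfolding Pt unfolding P_def using W F by (simp add: assoc_mult_mat[of _ ?n ?n _ ?n _ ?n])
  hence "transpose_mat P * P = 1\<^sub>m ?n" using F FF by (simp add: WW)
  moreover have "H = P * mat_diag ?n d * transpose_mat P"
  proof -
    have D: "mat_diag ?n d \<in> carrier_mat ?n ?n" by simp
    have "P * mat_diag ?n d * transpose_mat P = W * (F * mat_diag ?n d * transpose_mat F) * W"
      unfolding Pt unfolding P_def using W F D
      by (simp add: assoc_mult_mat[of _ ?n ?n _ ?n _ ?n] del: mat_diag_dim)
    thus ?thesis by (simp only: HK flip: KF)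
  qed
  moreover have "P \<in> carrier_mat ?n ?n" using W F by (simp add: P_def)
  ultimately show ?case by blast
qed

section \<open>Singular values and the spectral norm from a diagonalised Gram matrix\<close>

lemma mat_diag_mult_vec:
  assumes y: "y \<in> carrier_vec n"
  shows "mat_diag n d *\<^sub>v y = vec n (\<lambda>i. d i * y $ i)"
proof (rule eq_vecI)
  fix i assume "i < dim_vec (vec n (\<lambda>i. d i * y $ i))"
  hence i: "i < n" by simp
  thus "(mat_diag n d *\<^sub>v y) $ i = vec n (\<lambda>i. d i * y $ i) $ i"
    using y by (simp add: mat_diag_def scalar_prod_def atLeast0LessThan
        if_distrib[of "\<lambda>x. x * _"] cong: if_cong)
qed (simp add: mat_diag_def)

text \<open>In the coordinates \<open>transpose_mat P *\<^sub>v x\<close> the quadratic form is a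
  weighted sum of squares. Positivity, the spectral norm and the isometry property of an orthogonal
  \<open>P\<close> are all read off from this.\<close>

lemma scalar_prod_spectral:
  fixes P :: "real mat"
  assumes P: "P \<in> carrier_mat n n" and x: "x \<in> carrier_vec n"
  shows "x \<bullet> ((P * mat_diag n d * transpose_mat P) *\<^sub>v x) = (\<Sum>i<n. d i * ((transpose_mat P *\<^sub>v x) $ i)\<^sup>2)"
proof -
  let ?y = "transpose_mat P *\<^sub>v x"
  have y: "?y \<in> carrier_vec n" using P x by simp
  have D: "mat_diag n d \<in> carrier_mat n n" by simp
  have "x \<bullet> ((P * mat_diag n d * transpose_mat P) *\<^sub>v x) = ?y \<bullet> (mat_diag n d *\<^sub>v ?y)"
    using transpose_vec_mult_scalar[OF P _ x, of "mat_diag n d *\<^sub>v ?y"] P x y D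
    by (simp add: assoc_mult_mat_vec[of _ n n _ n])
  thus ?thesis
    using y unfolding mat_diag_mult_vec[OF y]
    by (simp add: scalar_prod_def atLeast0LessThan power2_eq_square mult_ac)
qed

text \<open>Similar matrices share their characteristic polynomial, and that of a diagonal matrix
  splits with the diagonal entries as its roots.\<close>

lemma singular_values_eq:
  assumes sim: "similar_mat (transpose_mat M * M) (mat_diag n d)"
  shows "singular_values M = rev (sort (map (\<lambda>i. sqrt (d i)) [0..<n]))"
proof -
  have ut: "upper_triangular (mat_diag n d)" by (auto simp: mat_diag_def)
  have diag: "diag_mat (mat_diag n d) = map d [0..<n]" by (auto simp: diag_mat_def mat_diag_def)
  \<comment> \<open>Roots are counted with multiplicity, so repeated diagonal entries survive as
    repeated singular values.\<close>
  have "proots (\<Prod>a\<leftarrow>xs. [:- a, 1:]) = mset xs" for xs :: "real list"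
  proof (induction xs)
    case (Cons a xs)
    have "(\<Prod>a\<leftarrow>xs. [:- a, 1:]) \<noteq> 0" by (auto simp: prod_list_zero_iff)
    hence "proots ([:- a, 1:] * (\<Prod>a\<leftarrow>xs. [:- a, 1:])) = proots [:- a, 1:] + proots (\<Prod>a\<leftarrow>xs. [:- a, 1:])"
      by (intro proots_mult) auto
    with Cons show ?case by simp
  qed simp
  hence "proots (char_poly (transpose_mat M * M)) = mset (map d [0..<n])"
    unfolding char_poly_similar[OF sim] char_poly_upper_triangular[OF mat_diag_dim ut] diag .
  hence "singular_values M = rev (sorted_list_of_multiset (image_mset sqrt (mset (map d [0..<n]))))"
    unfolding singular_values_def by simp
  also have "image_mset sqrt (mset (map d [0..<n])) = mset (map (\<lambda>i. sqrt (d i)) [0..<n])"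
    by (simp add: image_mset.compositionality comp_def flip: mset_map)
  finally show ?thesis by (simp only: sorted_list_of_multiset_mset)
qed

lemma similar_mat_spectral:
  fixes P :: "real mat"
  assumes "P \<in> carrier_mat n n" "transpose_mat P * P = 1\<^sub>m n"
  shows "similar_mat (P * mat_diag n d * transpose_mat P) (mat_diag n d)"
  using assms mat_mult_left_right_inverse[of "transpose_mat P" n P]
  unfolding similar_mat_def similar_mat_wit_def
  by (intro exI[of _ P] exI[of _ "transpose_mat P"]) (auto simp: Let_def)

lemma orthogonal_mult_unit_vec:
  fixes P :: "real mat"
  assumes P: "P \<in> carrier_mat n n" and PP: "transpose_mat P * P = 1\<^sub>m n" and i: "i < n"
  shows "transpose_mat P *\<^sub>v (P *\<^sub>v unit_vec n i) = unit_vec n i"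
    and "P *\<^sub>v unit_vec n i \<noteq> 0\<^sub>v n"
proof -
  show Pu: "transpose_mat P *\<^sub>v (P *\<^sub>v unit_vec n i) = unit_vec n i"
    using assoc_mult_mat_vec[of "transpose_mat P" n n P n "unit_vec n i"] P PP by simp
  have "transpose_mat P *\<^sub>v 0\<^sub>v n = 0\<^sub>v n" using P by (intro eq_vecI) auto
  moreover have "unit_vec n i \<noteq> (0\<^sub>v n :: real vec)"
    using i by (auto simp: vec_eq_iff)
  ultimately show "P *\<^sub>v unit_vec n i \<noteq> 0\<^sub>v n" using Pu by metis
qed

lemma rev_sort_nth_0:
  assumes "xs \<noteq> []"
  shows "rev (sort xs) ! 0 = Max (set xs)"
proof (rule Max_eqI[symmetric])
  show "rev (sort xs) ! 0 \<in> set xs"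
    using assms nth_mem[of 0 "rev (sort xs)"] by simp
  fix y assume "y \<in> set xs"
  then obtain i where "i < length xs" "y = sort xs ! i"
    by (metis in_set_conv_nth length_sort set_sort)
  thus "y \<le> rev (sort xs) ! 0"
    using sorted_nth_mono[OF sorted_sort, of i "length xs - 1" xs] assms by (simp add: rev_nth)
qed simp

text \<open>With y = P^T x, the squared length of M x is the sum of the d_i y_i^2, and y is a unit
  vector whenever x is. The largest d_i bounds this sum and is attained at the matching column of
  P.\<close>

lemma spectral_norm_eq_singular_value:
  assumes M: "M \<in> carrier_mat m n" and n: "1 \<le> n"
  shows "spectral_norm M = singular_value 1 M"
proof -
  let ?G = "transpose_mat M * M"
  have G: "?G \<in> carrier_mat n n" "transpose_mat ?G = ?G"
    using M by (auto simp: transpose_mult[of _ n m _ n])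
  obtain P d where P: "P \<in> carrier_mat n n" and PP: "transpose_mat P * P = 1\<^sub>m n"
    and GP: "?G = P * mat_diag n d * transpose_mat P"
    using real_spectral_theorem[OF G] by blast
  have PP': "P * transpose_mat P = 1\<^sub>m n"
    using mat_mult_left_right_inverse[OF _ P PP] P by simp
  have sq: "(M *\<^sub>v x) \<bullet> (M *\<^sub>v x) = (\<Sum>i<n. d i * ((transpose_mat P *\<^sub>v x) $ i)\<^sup>2)"
    if x: "x \<in> carrier_vec n" for x
  proof -
    have "(M *\<^sub>v x) \<bullet> (M *\<^sub>v x) = x \<bullet> (?G *\<^sub>v x)"
      using transpose_vec_mult_scalar[of "transpose_mat M" n m "M *\<^sub>v x" x] M x
      by (simp add: assoc_mult_mat_vec[of _ n m _ n])
    thus ?thesis using scalar_prod_spectral[OF P x, of d] GP by simp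
  qed
  \<comment> \<open>With all weights equal to 1 the matrix of the form is
    \<open>P * transpose_mat P\<close>, the identity.\<close>
  have isom: "(\<Sum>i<n. ((transpose_mat P *\<^sub>v x) $ i)\<^sup>2) = x \<bullet> x" if x: "x \<in> carrier_vec n" for x
    using scalar_prod_spectral[OF P x, of "\<lambda>_. 1"] P x PP' by simp
  note Pu = orthogonal_mult_unit_vec(1)[OF P PP]
  \<comment> \<open>Column i of \<open>P\<close> becomes the i-th unit vector in the rotated
    coordinates, so only \<open>d i\<close> remains of the sum.\<close>
  have ev: "(M *\<^sub>v (P *\<^sub>v unit_vec n i)) \<bullet> (M *\<^sub>v (P *\<^sub>v unit_vec n i)) = d i" if i: "i < n" for i
  proof -
    have "(\<Sum>j<n. d j * (unit_vec n i $ j)\<^sup>2) = (\<Sum>j<n. if j = i then d i else 0)"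
      using i by (intro sum.cong) auto
    thus ?thesis using sq[of "P *\<^sub>v unit_vec n i"] P i by (simp add: Pu[OF i])
  qed
  have unit: "(P *\<^sub>v unit_vec n i) \<bullet> (P *\<^sub>v unit_vec n i) = 1" if i: "i < n" for i
  proof -
    have "(\<Sum>j<n. (unit_vec n i $ j :: real)\<^sup>2) = (\<Sum>j<n. if j = i then 1 else 0)"
      using i by (intro sum.cong) auto
    thus ?thesis using isom[of "P *\<^sub>v unit_vec n i"] P i by (simp add: Pu[OF i])
  qed
  have "singular_value 1 M = Max ((\<lambda>i. sqrt (d i)) ` {0..<n})"
    using singular_values_eq[of M n d] similar_mat_spectral[OF P PP, of d]
      rev_sort_nth_0[of "map (\<lambda>i. sqrt (d i)) [0..<n]"] n
    by (simp add: singular_value_def GP)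
  moreover have "Max ((\<lambda>i. sqrt (d i)) ` {0..<n}) \<in> (\<lambda>i. sqrt (d i)) ` {0..<n}"
    using n by (intro Max_in) auto
  ultimately obtain k where k: "k < n" and sv: "singular_value 1 M = sqrt (d k)"
    and Max: "Max ((\<lambda>i. sqrt (d i)) ` {0..<n}) = sqrt (d k)"
    by auto
  \<comment> \<open>The real \<open>sqrt\<close> is strictly increasing on the whole line, negative
    arguments included, so comparing roots compares the \<open>d i\<close> before their signs are
    known.\<close>
  have dk: "d i \<le> d k" if "i < n" for i
    using Max_ge[of "(\<lambda>i. sqrt (d i)) ` {0..<n}" "sqrt (d i)"] that Max by simp
  show ?thesis
    unfolding spectral_norm_def sv
  proof (rule cSup_eq_maximum)
    show "sqrt (d k) \<in> (\<lambda>x. euclidean_norm (M *\<^sub>v x)) `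
        {x \<in> carrier_vec (dim_col M). euclidean_norm x = 1}"
      using P M k ev[OF k] unit[OF k]
      by (intro image_eqI[of _ _ "P *\<^sub>v unit_vec n k"]) (auto simp: euclidean_norm_def)
    fix y assume "y \<in> (\<lambda>x. euclidean_norm (M *\<^sub>v x)) ` {x \<in> carrier_vec (dim_col M). euclidean_norm x = 1}"
    then obtain x where x: "x \<in> carrier_vec n" "x \<bullet> x = 1" and y: "y = euclidean_norm (M *\<^sub>v x)"
      using M by (auto simp: euclidean_norm_def)
    have "(M *\<^sub>v x) \<bullet> (M *\<^sub>v x) \<le> (\<Sum>i<n. d k * ((transpose_mat P *\<^sub>v x) $ i)\<^sup>2)"
      unfolding sq[OF x(1)] by (intro sum_mono mult_right_mono) (auto simp: dk)
    also have "\<dots> = d k" using isom[OF x(1)] x(2) by (simp flip: sum_distrib_left)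
    finally show "y \<le> sqrt (d k)" by (simp add: y euclidean_norm_def)
  qed
qed

section \<open>Positive definite matrices and their square roots\<close>

text \<open>Each \<open>d i\<close> is the value of the quadratic form at column i of
  \<open>P\<close>.\<close>

lemma spd_spectral:
  assumes "spd n H"
  obtains P d where "P \<in> carrier_mat n n" "transpose_mat P * P = 1\<^sub>m n"
    "H = P * mat_diag n d * transpose_mat P" "\<And>i. i < n \<Longrightarrow> 0 < d i"
proof -
  from assms have H: "H \<in> carrier_mat n n" "transpose_mat H = H"
    and pos: "\<And>x. x \<in> carrier_vec n \<Longrightarrow> x \<noteq> 0\<^sub>v n \<Longrightarrow> 0 < x \<bullet> (H *\<^sub>v x)"
    by (auto simp: spd_def)
  obtain P d where P: "P \<in> carrier_mat n n" and PP: "transpose_mat P * P = 1\<^sub>m n"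
    and HP: "H = P * mat_diag n d * transpose_mat P"
    using real_spectral_theorem[OF H] by blast
  have "0 < d i" if i: "i < n" for i
  proof -
    let ?x = "P *\<^sub>v unit_vec n i"
    note Px = orthogonal_mult_unit_vec[OF P PP i]
    have "0 < ?x \<bullet> (H *\<^sub>v ?x)" using pos P Px(2) by simp
    also have "\<dots> = (\<Sum>j<n. d j * (unit_vec n i $ j)\<^sup>2)"
      using scalar_prod_spectral[OF P, of ?x d] P HP by (simp add: Px)
    also have "\<dots> = (\<Sum>j<n. if j = i then d i else 0)"
      using i by (intro sum.cong) auto
    finally show ?thesis using i by simp
  qed
  thus thesis using that P PP HP by blast
qed

lemma transpose_spectral:
  fixes P :: "real mat"
  assumes P: "P \<in> carrier_mat n n"
  shows "transpose_mat (P * mat_diag n d * transpose_mat P) = P * mat_diag n d * transpose_mat P"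
proof -
  have "transpose_mat (mat_diag n d) = mat_diag n d" by (rule eq_matI) (auto simp: mat_diag_def)
  thus ?thesis
    using P mat_diag_dim[of n d]
    by (simp add: transpose_mult[of _ n n _ n] assoc_mult_mat[of _ n n _ n _ n] del: mat_diag_dim)
qed

lemma spectral_mult:
  fixes P :: "real mat"
  assumes P: "P \<in> carrier_mat n n" and PP: "transpose_mat P * P = 1\<^sub>m n"
  shows "(P * mat_diag n d * transpose_mat P) * (P * mat_diag n d' * transpose_mat P)
    = P * mat_diag n (\<lambda>i. d i * d' i) * transpose_mat P"
proof -
  have "(P * mat_diag n d * transpose_mat P) * (P * mat_diag n d' * transpose_mat P)
    = P * mat_diag n d * (transpose_mat P * P) * mat_diag n d' * transpose_mat P"
    using P mat_diag_dim[of n d] mat_diag_dim[of n d'] by (simp add: assoc_mult_mat[of _ n n _ n _ n] del: mat_diag_dim)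
  also have "\<dots> = P * (mat_diag n d * mat_diag n d') * transpose_mat P"
    unfolding PP using P mat_diag_dim[of n d] mat_diag_dim[of n d']
    by (simp add: assoc_mult_mat[of _ n n _ n _ n] del: mat_diag_diag mat_diag_dim)
  finally show ?thesis by simp
qed

text \<open>Since P P^T = I, a nonzero x has a nonzero rotated coordinate, which contributes a
  positive term to the weighted sum of squares.\<close>

lemma spd_of_spectral:
  fixes P :: "real mat"
  assumes P: "P \<in> carrier_mat n n" and PP: "transpose_mat P * P = 1\<^sub>m n"
    and d: "\<And>i. i < n \<Longrightarrow> 0 < d i"
  shows "spd n (P * mat_diag n d * transpose_mat P)"
  unfolding spd_def
proof (intro conjI ballI impI)
  show "transpose_mat (P * mat_diag n d * transpose_mat P) = P * mat_diag n d * transpose_mat P"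
    by (rule transpose_spectral[OF P])
  fix x :: "real vec" assume x: "x \<in> carrier_vec n" "x \<noteq> 0\<^sub>v n"
  let ?y = "transpose_mat P *\<^sub>v x"
  have "P *\<^sub>v ?y = x"
    using mat_mult_left_right_inverse[OF _ P PP] assoc_mult_mat_vec[of P n n "transpose_mat P" n x] P x by simp
  moreover have "P *\<^sub>v 0\<^sub>v n = 0\<^sub>v n" using P by (intro eq_vecI) auto
  ultimately have "?y \<noteq> 0\<^sub>v n" using x(2) by metis
  then obtain i where i: "i < n" "?y $ i \<noteq> 0"
    using P by (auto simp: vec_eq_iff)
  have "0 < (\<Sum>i<n. d i * (?y $ i)\<^sup>2)"
    by (rule sum_pos2[of _ i]) (use i d in \<open>auto intro!: mult_pos_pos mult_nonneg_nonneg less_imp_le[OF d]\<close>)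
  thus "0 < x \<bullet> ((P * mat_diag n d * transpose_mat P) *\<^sub>v x)"
    by (simp only: scalar_prod_spectral[OF P x(1)])
qed (use P mat_diag_dim[of n d] in auto)

text \<open>Needed for the definite description in \<open>sqrt_mat\<close> to denote. The difference
  \<open>B - C\<close> is symmetric, and a symmetric matrix all of whose eigenvalues vanish is
  zero.\<close>

lemma spd_sqrt_unique:
  assumes B: "spd n B" and C: "spd n C" and BC: "B * B = C * C"
  shows "B = C"
proof -
  from B C have B': "B \<in> carrier_mat n n" "transpose_mat B = B"
    and C': "C \<in> carrier_mat n n" "transpose_mat C = C" by (auto simp: spd_def)
  have X: "B - C \<in> carrier_mat n n" "transpose_mat (B - C) = B - C"
    using B' C' by (auto simp: transpose_minus[of _ n n])
  obtain P d where P: "P \<in> carrier_mat n n" and PP: "transpose_mat P * P = 1\<^sub>m n"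
    and XP: "B - C = P * mat_diag n d * transpose_mat P"
    using real_spectral_theorem[OF X] by blast
  \<comment> \<open>An eigenvalue of B - C with eigenvector v satisfies
    d (v.Bv + v.Cv) = (Bv - Cv).(Bv + Cv) = v.BBv - v.CCv = 0.\<close>
  have d: "d i = 0" if i: "i < n" for i
  proof -
    let ?v = "P *\<^sub>v unit_vec n i"
    have v: "?v \<in> carrier_vec n" using P by simp
    note Pv = orthogonal_mult_unit_vec[OF P PP i]
    have pos: "0 < ?v \<bullet> (B *\<^sub>v ?v) + ?v \<bullet> (C *\<^sub>v ?v)"
      using B C v Pv(2) by (auto simp: spd_def intro!: add_pos_pos)
    have "mat_diag n d *\<^sub>v unit_vec n i = d i \<cdot>\<^sub>v unit_vec n i"
      using i by (subst mat_diag_mult_vec) auto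
    hence "(B - C) *\<^sub>v ?v = d i \<cdot>\<^sub>v ?v"
      unfolding XP using P v mat_diag_dim[of n d]
      by (simp add: assoc_mult_mat_vec[of _ n n _ n] Pv mult_mat_vec del: mat_diag_dim)
    hence dv: "B *\<^sub>v ?v - C *\<^sub>v ?v = d i \<cdot>\<^sub>v ?v"
      using B' C' v by (simp add: minus_mult_distrib_mat_vec)
    have sq: "(B *\<^sub>v ?v) \<bullet> (B *\<^sub>v ?v) = (C *\<^sub>v ?v) \<bullet> (C *\<^sub>v ?v)"
      using transpose_vec_mult_scalar[of B n n "B *\<^sub>v ?v" ?v] transpose_vec_mult_scalar[of C n n "C *\<^sub>v ?v" ?v]
        transpose_vec_mult_scalar[OF B'(1) v, of "B *\<^sub>v ?v"] transpose_vec_mult_scalar[OF C'(1) v, of "C *\<^sub>v ?v"]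
        B' C' v arg_cong[OF BC, of "\<lambda>X. ?v \<bullet> (X *\<^sub>v ?v)"]
      by (simp add: assoc_mult_mat_vec[of _ n n _ n] comm_scalar_prod[of _ n])
    let ?b = "B *\<^sub>v ?v" and ?c = "C *\<^sub>v ?v"
    have bc: "?b \<in> carrier_vec n" "?c \<in> carrier_vec n" using B' C' v by auto
    have "d i * (?v \<bullet> ?b + ?v \<bullet> ?c) = (?b - ?c) \<bullet> (?b + ?c)"
      unfolding dv using bc v by (simp add: scalar_prod_add_distrib[of _ n] distrib_left)
    also have "\<dots> = 0"
      using bc sq comm_scalar_prod[OF bc]
      by (simp add: scalar_prod_add_distrib[of _ n] minus_scalar_prod_distrib[of _ n])
    finally show ?thesis using pos by auto
  qed
  have D: "mat_diag n d = 0\<^sub>m n n" using d by (auto simp: mat_diag_def)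
  have "B - C = 0\<^sub>m n n" unfolding XP D using P by simp
  hence "B $$ (i,j) - C $$ (i,j) = 0" if "i < n" "j < n" for i j
    using that B' C' by (metis index_minus_mat(1) index_zero_mat(1) carrier_matD)
  thus ?thesis using B' C' by (intro eq_matI) auto
qed

text \<open>Existence takes square roots of the positive eigenvalues; with uniqueness, the definite
  description can be unfolded.\<close>

lemma sqrt_mat:
  assumes A: "spd n A"
  shows "spd n (sqrt_mat A)" "sqrt_mat A * sqrt_mat A = A"
proof -
  obtain P d where P: "P \<in> carrier_mat n n" and PP: "transpose_mat P * P = 1\<^sub>m n"
    and AP: "A = P * mat_diag n d * transpose_mat P" and d: "\<And>i. i < n \<Longrightarrow> 0 < d i"
    using spd_spectral[OF A] by metis
  let ?B = "P * mat_diag n (\<lambda>i. sqrt (d i)) * transpose_mat P"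
  have "mat_diag n (\<lambda>i. sqrt (d i) * sqrt (d i)) = mat_diag n d"
    using d by (auto simp: mat_diag_def less_imp_le)
  hence "?B * ?B = A" unfolding AP spectral_mult[OF P PP] by simp
  moreover have "spd n ?B" using d by (intro spd_of_spectral[OF P PP]) simp
  moreover have "dim_row A = n" using A by (auto simp: spd_def)
  ultimately have "\<exists>!B. spd (dim_row A) B \<and> B * B = A"
    using spd_sqrt_unique by metis
  from theI'[OF this] show "spd n (sqrt_mat A)" "sqrt_mat A * sqrt_mat A = A"
    using \<open>dim_row A = n\<close> by (auto simp: sqrt_mat_def)
qed

section \<open>Reciprocals, Gram matrices and column spaces\<close>

text \<open>Inversion reverses the order of positive reals. This is the source of the index n - i +
  1 in the formula for Q.\<close>

lemma rev_sort_map_inverse: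
  fixes xs :: "real list"
  assumes "\<And>x. x \<in> set xs \<Longrightarrow> 0 < x"
  shows "rev (sort (map inverse xs)) = map inverse (sort xs)"
proof -
  have "sorted_wrt (\<lambda>x y. inverse y \<le> inverse x) (sort xs)"
    by (rule sorted_wrt_mono_rel[OF _ sorted_sort]) (auto intro: le_imp_inverse_le assms)
  hence "sorted (rev (map inverse (sort xs)))"
    by (simp add: sorted_wrt_rev sorted_wrt_map)
  hence "sort (map inverse xs) = rev (map inverse (sort xs))"
    by (intro properties_for_sort) simp_all
  thus ?thesis by simp
qed

text \<open>Symmetry of the root lets its two copies meet and multiply to \<open>A\<close>, so the
  Gram matrices of the theorem can be written in \<open>A\<close> alone.\<close>

lemma gram_sqrt_mat_mult:
  assumes A: "spd m A" and X: "X \<in> carrier_mat m n"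
  shows "transpose_mat (sqrt_mat A * X) * (sqrt_mat A * X) = transpose_mat X * A * X"
proof -
  let ?B = "sqrt_mat A"
  have B: "?B \<in> carrier_mat m m" and Bt: "transpose_mat ?B = ?B"
    using sqrt_mat(1)[OF A] by (auto simp: spd_def)
  have "transpose_mat (?B * X) * (?B * X) = transpose_mat X * (?B * ?B) * X"
    using B X by (simp add: transpose_mult[of _ m m _ n] Bt assoc_mult_mat[of _ n m _ m _ n]
        assoc_mult_mat[of _ m m _ m _ n] assoc_mult_mat[of _ n m _ m _ m])
  thus ?thesis by (simp only: sqrt_mat(2)[OF A])
qed

lemma column_space_eq:
  assumes "M \<in> carrier_mat m n"
  shows "column_space M = {y \<in> carrier_vec m. \<exists>x \<in> carrier_vec n. M *\<^sub>v x = y}"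
proof -
  interpret vec_space "TYPE(real)" m .
  show ?thesis using col_space_eq[OF assms] assms by (simp add: col_space_def column_space_def)
qed

text \<open>Each column of \<open>X\<close> is \<open>Y\<close> applied to some coefficient vector;
  these vectors are the columns of \<open>C\<close>.\<close>

lemma column_space_subset_factor:
  assumes X: "X \<in> carrier_mat m k" and Y: "Y \<in> carrier_mat m n"
    and sub: "column_space X \<subseteq> column_space Y"
  obtains C where "C \<in> carrier_mat n k" "X = Y * C"
proof -
  have "\<exists>x \<in> carrier_vec n. Y *\<^sub>v x = col X j" if j: "j < k" for j
  proof -
    have "X *\<^sub>v unit_vec k j = col X j"
      using X j by (intro eq_vecI) auto
    moreover have "X *\<^sub>v unit_vec k j \<in> column_space X"
      using X unfolding column_space_eq[OF X] by auto
    ultimately show ?thesis using sub unfolding column_space_eq[OF Y] by auto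
  qed
  then obtain x where x: "\<And>j. j < k \<Longrightarrow> x j \<in> carrier_vec n" "\<And>j. j < k \<Longrightarrow> Y *\<^sub>v x j = col X j"
    by metis
  define C where "C = mat_of_cols n (map x [0..<k])"
  have C: "C \<in> carrier_mat n k" by (simp add: C_def carrier_matI)
  have colC: "col C j = x j" if "j < k" for j
    using that x(1)[OF that] by (simp add: C_def)
  have "X = Y * C"
  proof (rule eq_matI)
    fix i j assume "i < dim_row (Y * C)" "j < dim_col (Y * C)"
    hence i: "i < m" and j: "j < k" using Y C by auto
    thus "X $$ (i,j) = (Y * C) $$ (i,j)"
      using X Y C colC[OF j] arg_cong[OF x(2)[OF j], of "\<lambda>v. v $ i"] by simp
  qed (use X Y C in auto)
  with C that show thesis by blast
qed

text \<open>Conjugation by S with inverse U: U (S S^T) S = S^T S.\<close>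

lemma similar_mat_gram_comm:
  fixes S U :: "real mat"
  assumes S: "S \<in> carrier_mat n n" and U: "U \<in> carrier_mat n n" and SU: "S * U = 1\<^sub>m n"
  shows "similar_mat (transpose_mat S * S) (S * transpose_mat S)"
proof -
  have US: "U * S = 1\<^sub>m n" by (rule mat_mult_left_right_inverse[OF S U SU])
  have "U * (S * transpose_mat S) * S = (U * S) * (transpose_mat S * S)"
    using S U by (simp add: assoc_mult_mat[of _ n n _ n _ n])
  hence "U * (S * transpose_mat S) * S = transpose_mat S * S"
    using S by (simp add: US)
  hence "similar_mat_wit (transpose_mat S * S) (S * transpose_mat S) U S"
    using S U SU US by (auto simp: similar_mat_wit_def Let_def)
  thus ?thesis by (auto simp: similar_mat_def)
qed

text \<open>Inverting a matrix keeps its eigenvectors and takes reciprocals of its eigenvalues,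
  which gives the right inverse \<open>?V\<close>. The left inverse \<open>W\<close> must coincide
  with it.\<close>

lemma similar_mat_inverse_spectral:
  fixes P W :: "real mat"
  assumes P: "P \<in> carrier_mat n n" and PP: "transpose_mat P * P = 1\<^sub>m n"
    and d: "\<And>i. i < n \<Longrightarrow> d i \<noteq> 0"
    and W: "W \<in> carrier_mat n n" and WG: "W * (P * mat_diag n d * transpose_mat P) = 1\<^sub>m n"
  shows "similar_mat W (mat_diag n (\<lambda>i. inverse (d i)))"
proof -
  let ?G = "P * mat_diag n d * transpose_mat P"
  let ?V = "P * mat_diag n (\<lambda>i. inverse (d i)) * transpose_mat P"
  have G: "?G \<in> carrier_mat n n" and V: "?V \<in> carrier_mat n n"
    using P mat_diag_dim[of n d] mat_diag_dim[of n "\<lambda>i. inverse (d i)"] by (auto simp del: mat_diag_dim)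
  have "mat_diag n (\<lambda>i. d i * inverse (d i)) = 1\<^sub>m n"
    using d by (auto simp: mat_diag_def)
  hence "?G * ?V = 1\<^sub>m n"
    unfolding spectral_mult[OF P PP] using P mat_mult_left_right_inverse[OF _ P PP] by simp
  hence "W = W * ?G * ?V"
    using assoc_mult_mat[OF W G V] W by simp
  hence "W = ?V" unfolding WG left_mult_one_mat[OF V] .
  thus ?thesis using similar_mat_spectral[OF P PP] by simp
qed

section \<open>Singular values of the oblique factors\<close>

theorem theorem1p1:
  fixes m n :: nat and A Z Zhat Q R :: "real mat"
  assumes "1 \<le> n" and "n \<le> m"
    and "spd m A"
    and "Z \<in> carrier_mat m n" and "vec_space.rank m Z = n"
    and "Zhat \<in> carrier_mat m n" and "orthonormal_basis_columns Zhat (column_space Z)"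
    and "oblique_QR A Z Q R"
  shows "(\<forall>i \<in> {1..n}.
            singular_value (n - i + 1) (sqrt_mat A * Zhat) \<noteq> 0 \<and>
            singular_value i Q = inverse (singular_value (n - i + 1) (sqrt_mat A * Zhat)) \<and>
            singular_value i R = singular_value i (sqrt_mat A * Z)) \<and>
         spectral_norm Q = inverse (singular_value n (sqrt_mat A * Zhat)) \<and>
         spectral_norm R = spectral_norm (sqrt_mat A * Z)"
proof -
  note n = \<open>1 \<le> n\<close> and spdA = \<open>spd m A\<close> and Z = \<open>Z \<in> carrier_mat m n\<close>
    and Zh = \<open>Zhat \<in> carrier_mat m n\<close>
  have A: "A \<in> carrier_mat m m" using spdA by (simp add: spd_def)
  have B: "sqrt_mat A \<in> carrier_mat m m" using sqrt_mat(1)[OF spdA] by (simp add: spd_def)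
  have Q: "Q \<in> carrier_mat m n" and R: "R \<in> carrier_mat n n" and ZQR: "Z = Q * R"
    and QAQ: "transpose_mat Q * A * Q = 1\<^sub>m n"
    using \<open>oblique_QR A Z Q R\<close> Z by (auto simp: oblique_QR_def)
  have orth: "col Zhat i \<bullet> col Zhat j = (if i = j then 1 else 0)" if "i < n" "j < n" for i j
    using \<open>orthonormal_basis_columns Zhat (column_space Z)\<close> Zh that
    by (auto simp: orthonormal_basis_columns_def)
  have ZZ: "transpose_mat Zhat * Zhat = 1\<^sub>m n"
    by (rule eq_matI) (use Zh orth in auto)

  \<comment> \<open>Substituting Z = Q R leaves Q^T A Q in the middle, which is the
    identity.\<close>
  have "transpose_mat (sqrt_mat A * Z) * (sqrt_mat A * Z) = transpose_mat R * (transpose_mat Q * A * Q) * R"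
    unfolding gram_sqrt_mat_mult[OF spdA Z] unfolding ZQR using Q R A
    by (simp add: transpose_mult[of _ m n _ n] assoc_mult_mat[of _ n n _ m _ m]
        assoc_mult_mat[of _ n n _ m _ n] assoc_mult_mat[of _ n m _ m _ n] assoc_mult_mat[of _ n m _ n _ n]
        assoc_mult_mat[of _ m n _ n _ n] assoc_mult_mat[of _ m m _ n _ n] assoc_mult_mat[of _ n n _ n _ n])
  hence gramR: "transpose_mat R * R = transpose_mat (sqrt_mat A * Z) * (sqrt_mat A * Z)"
    using R by (simp add: QAQ)
  \<comment> \<open>\<open>singular_values\<close> depends on the Gram matrix alone, so
    \<open>gramR\<close> suffices even when the row counts differ.\<close>
  have svR: "singular_value i R = singular_value i (sqrt_mat A * Z)" for i
    by (simp add: singular_value_def singular_values_def gramR)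
  have normR: "spectral_norm R = spectral_norm (sqrt_mat A * Z)"
    using spectral_norm_eq_singular_value[OF R n] spectral_norm_eq_singular_value[of "sqrt_mat A * Z" m n] B Z n
    by (simp add: svR)

  \<comment> \<open>The inclusion gives Zhat = Z C = Q (R C). By orthonormality (Zhat^T Q) (R C) =
    I, so \<open>U = R * C\<close> inverts \<open>S\<close>.\<close>
  have "column_space Zhat \<subseteq> column_space Z"
    using \<open>orthonormal_basis_columns Zhat (column_space Z)\<close> by (simp add: orthonormal_basis_columns_def)
  then obtain C where C: "C \<in> carrier_mat n n" and ZC: "Zhat = Z * C"
    by (rule column_space_subset_factor[OF Zh Z])
  define U where "U = R * C"
  have U: "U \<in> carrier_mat n n" using R C by (simp add: U_def)
  have ZQU: "Zhat = Q * U"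
    unfolding ZC ZQR U_def using Q R C by (simp add: assoc_mult_mat[of _ m n _ n _ n])
  define S where "S = transpose_mat Zhat * Q"
  have S: "S \<in> carrier_mat n n" using Zh Q by (simp add: S_def)
  have SU: "S * U = 1\<^sub>m n"
  proof -
    have "S * U = transpose_mat Zhat * (Q * U)"
      unfolding S_def using Zh Q U by (simp add: assoc_mult_mat[of _ n m _ n _ n])
    thus ?thesis by (simp add: ZZ flip: ZQU)
  qed
  have US: "U * S = 1\<^sub>m n" by (rule mat_mult_left_right_inverse[OF S U SU])
  \<comment> \<open>The identity U S = I turns Zhat = Q U around: Q = Q U S = Zhat S.\<close>
  have QS: "Q = Zhat * S"
  proof -
    have "Zhat * S = Q * (U * S)"
      unfolding ZQU using Q U S by (simp add: assoc_mult_mat[of _ m n _ n _ n])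
    thus ?thesis using Q by (simp add: US)
  qed
  have gramQ: "transpose_mat Q * Q = transpose_mat S * S"
  proof -
    have "transpose_mat Q * Q = transpose_mat S * (transpose_mat Zhat * Zhat) * S"
      unfolding QS using Zh S by (simp add: transpose_mult[of _ m n _ n] assoc_mult_mat[of _ n n _ m _ n]
          assoc_mult_mat[of _ n m _ n _ n] assoc_mult_mat[of _ n n _ n _ n])
    thus ?thesis using S by (simp add: ZZ)
  qed

  \<comment> \<open>By \<open>gram_sqrt_mat_mult\<close> this is the Gram matrix of
    \<open>sqrt_mat A * Zhat\<close>.\<close>
  define G where "G = transpose_mat Zhat * A * Zhat"
  have G: "G \<in> carrier_mat n n" using Zh A by (simp add: G_def)
  have SGS: "transpose_mat S * G * S = 1\<^sub>m n"
  proof -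
    have "transpose_mat Q * A * Q = transpose_mat S * G * S"
      unfolding QS G_def using Zh S A by (simp add: transpose_mult[of _ m n _ n] assoc_mult_mat[of _ n n _ m _ m]
          assoc_mult_mat[of _ n n _ m _ n] assoc_mult_mat[of _ n m _ m _ n] assoc_mult_mat[of _ n m _ n _ n]
          assoc_mult_mat[of _ m m _ n _ n] assoc_mult_mat[of _ n n _ n _ n])
    thus ?thesis using QAQ by simp
  qed
  \<comment> \<open>By \<open>SGS\<close>, S^T G is a left inverse of the square matrix S, hence
    also a right inverse; regrouping makes S S^T a left inverse of G.\<close>
  have "S * (transpose_mat S * G) = 1\<^sub>m n"
    using mat_mult_left_right_inverse[OF _ S SGS] S G by simp
  hence SSG: "S * transpose_mat S * G = 1\<^sub>m n"
    using S G by (simp add: assoc_mult_mat[of _ n n _ n _ n])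
  \<comment> \<open>\<open>Zhat\<close> is injective because its columns are orthonormal, so
    positivity passes from \<open>A\<close> to \<open>G\<close>. This makes the eigenvalues
    \<open>d i\<close> positive and their reciprocals meaningful.\<close>
  have spdG: "spd n G"
    unfolding spd_def
  proof (intro conjI ballI impI)
    show "transpose_mat G = G"
      unfolding G_def using Zh A spdA
      by (simp add: spd_def transpose_mult[of _ n m _ n] transpose_mult[of _ n m _ m] transpose_mult[of _ m m _ n]
          assoc_mult_mat[of _ n m _ m _ n])
    fix x :: "real vec" assume x: "x \<in> carrier_vec n" "x \<noteq> 0\<^sub>v n"
    have "transpose_mat Zhat *\<^sub>v (Zhat *\<^sub>v x) = x"
      using ZZ Zh x assoc_mult_mat_vec[of "transpose_mat Zhat" n m Zhat n x] by simp
    moreover have "transpose_mat Zhat *\<^sub>v 0\<^sub>v m = 0\<^sub>v n" using Zh by (intro eq_vecI) auto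
    ultimately have "Zhat *\<^sub>v x \<noteq> 0\<^sub>v m" using x(2) by metis
    hence "0 < (Zhat *\<^sub>v x) \<bullet> (A *\<^sub>v (Zhat *\<^sub>v x))"
      using spdA Zh x by (simp add: spd_def)
    also have "\<dots> = x \<bullet> (transpose_mat Zhat *\<^sub>v (A *\<^sub>v (Zhat *\<^sub>v x)))"
      using transpose_vec_mult_scalar[of "transpose_mat Zhat" n m "A *\<^sub>v (Zhat *\<^sub>v x)" x] Zh A x by simp
    also have "\<dots> = x \<bullet> (G *\<^sub>v x)"
      unfolding G_def using Zh A x
      by (simp add: assoc_mult_mat_vec[of _ n m _ n] assoc_mult_mat_vec[of _ n m _ m])
    finally show "0 < x \<bullet> (G *\<^sub>v x)" .
  qed (rule G)
  obtain P d where P: "P \<in> carrier_mat n n" and PP: "transpose_mat P * P = 1\<^sub>m n"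
    and GP: "G = P * mat_diag n d * transpose_mat P" and d: "\<And>i. i < n \<Longrightarrow> 0 < d i"
    using spd_spectral[OF spdG] by metis
  \<comment> \<open>\<open>L\<close> is ascending: reversed, it lists the singular values of A^(1/2)
    Zhat; inverted entrywise, it lists those of Q, already in non-increasing order.\<close>
  define L where "L = sort (map (\<lambda>i. sqrt (d i)) [0..<n])"
  have L: "length L = n" "\<And>i. i < n \<Longrightarrow> 0 < L ! i"
  proof -
    show len: "length L = n" by (simp add: L_def)
    fix i assume "i < n"
    hence "L ! i \<in> set L" by (simp add: len)
    thus "0 < L ! i" using d by (auto simp: L_def)
  qed
  have svZ: "singular_values (sqrt_mat A * Zhat) = rev L"
    unfolding L_def using similar_mat_spectral[OF P PP, of d]
    by (intro singular_values_eq) (simp add: gram_sqrt_mat_mult[OF spdA Zh] flip: G_def GP)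
  have "similar_mat (S * transpose_mat S) (mat_diag n (\<lambda>i. inverse (d i)))"
    using similar_mat_inverse_spectral[OF P PP, of d] d S SSG GP by (metis less_irrefl mult_carrier_mat transpose_carrier_mat)
  hence "similar_mat (transpose_mat Q * Q) (mat_diag n (\<lambda>i. inverse (d i)))"
    unfolding gramQ using similar_mat_gram_comm[OF S U SU] similar_mat_trans by blast
  hence "singular_values Q = rev (sort (map inverse (map (\<lambda>i. sqrt (d i)) [0..<n])))"
    by (simp add: singular_values_eq real_sqrt_inverse comp_def)
  also have "\<dots> = map inverse L"
    unfolding L_def using d by (intro rev_sort_map_inverse) auto
  finally have svQ: "singular_values Q = map inverse L" .
  \<comment> \<open>Position n - i + 1 counted from 1 is index n - i counted from 0, and reversal of
    a list of length n takes that index to i - 1.\<close>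
  have svZ': "singular_value (n - i + 1) (sqrt_mat A * Zhat) = L ! (i - 1)" if "i \<in> {1..n}" for i
    using that L(1) by (auto simp: singular_value_def svZ rev_nth)
  have svQ': "singular_value i Q = inverse (L ! (i - 1))" if "i \<in> {1..n}" for i
    using that L(1) by (auto simp: singular_value_def svQ)
  \<comment> \<open>The case i = 1, where n - i + 1 = n.\<close>
  have "spectral_norm Q = inverse (singular_value n (sqrt_mat A * Zhat))"
    using spectral_norm_eq_singular_value[OF Q n] svQ'[of 1] svZ'[of 1] n by simp
  moreover have "L ! (i - 1) \<noteq> 0" if "i \<in> {1..n}" for i
  proof -
    have "i - 1 < n" using that by auto
    from L(2)[OF this] show ?thesis by simp
  qed
  ultimately show ?thesis using svQ' svZ' svR normR by simp
qed

end
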